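(* For an integer $n\ge 1$, let $\mathrm{Dic}_n$ be the dicyclic group of order $4n$ with generators $a,x$, let $U$ be the uniform distribution on $\mathrm{Dic}_n$, and let $Q$ be the probability measure on $\mathrm{Dic}_n$ such that $Q(a)=Q(a^{2n-1})=Q(x)=Q(a^n x)=\tfrac14$. Let $Q^{*k}$ be the $k$-fold convolution of $Q$ with itself. (i) For any odd integer $n\ge 1$ and any integer $k\ge 1$, $$\| Q^{*k} - U \|_{\mathrm{TV}}^2 \le \frac{3n-1}{4}\cdot \frac{1}{4^k} + \frac{\exp(-\pi^2 k/(2n^2))}{2 \left(1-\exp(-3\pi^2 k / (2n^2))\right)}.$$ (ii) For any odd integer $n\ge 7$ and any integer $k\ge 1$, $$\frac{1}{4} \exp \left( -\frac{\pi^2 k}{4n^2} - \frac{\pi^4 k} {96 n^4} - \frac{\pi^5 k}{400n^5} \right) - \frac{1}{2^{k+2}} \le \| Q^{*k} - U \|_{\mathrm{TV}}.$$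
   Context: The dicyclic group $\mathrm{Dic}_n$ (of order $4n$) has presentation $\langle a, x \mid a^{2n}=1,\ x^2=a^n,\ xax^{-1}=a^{-1}\rangle$. Its $4n$ elements are $1,a,\dots,a^{2n-1},x,ax,\dots,a^{2n-1}x$, with multiplication (exponents modulo $2n$): $(a^k)(a^m)=a^{k+m}$, $(a^k)(a^mx)=a^{k+m}x$, $(a^kx)(a^m)=a^{k-m}x$, $(a^kx)(a^mx)=a^{k-m+n}$. $U(s)=1/(4n)$ for all $s\in\mathrm{Dic}_n$. Convolution powers: $Q^{*1}=Q$ and $Q^{*k}(s)=\sum_{t\in \mathrm{Dic}_n} Q(st^{-1})\,Q^{*(k-1)}(t)$ for $k\ge 2$. Total variation distance: $\|P_1-P_2\|_{\mathrm{TV}}=\max_{A\subseteq \mathrm{Dic}_n}|P_1(A)-P_2(A)|$. *)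

theory Defs
  imports "HOL-Algebra.Group" "HOL-Probability.Probability_Mass_Function"
begin

text \<open>The pair \<open>(k, False)\<close> stands for $a^k$ and \<open>(k, True)\<close> for $a^k x$,
  with exponents normalised to $0 \le k < 2n$.\<close>

fun dic_mult :: "nat \<Rightarrow> int \<times> bool \<Rightarrow> int \<times> bool \<Rightarrow> int \<times> bool" where
  "dic_mult n (k, False) (m, False) = ((k + m) mod (2 * int n), False)"
| "dic_mult n (k, False) (m, True) = ((k + m) mod (2 * int n), True)"
| "dic_mult n (k, True) (m, False) = ((k - m) mod (2 * int n), True)"
| "dic_mult n (k, True) (m, True) = ((k - m + int n) mod (2 * int n), False)"

definition Dic :: "nat \<Rightarrow> (int \<times> bool) monoid" where
  "Dic n = \<lparr>carrier = {0..<2 * int n} \<times> UNIV, monoid.mult = dic_mult n, one = (0, False)\<rparr>"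

definition dic_a :: "int \<times> bool" where "dic_a = (1, False)"
definition dic_x :: "int \<times> bool" where "dic_x = (0, True)"

text \<open>Functions on a group stand for mass functions. The exponent \<open>0\<close> (the point mass at the
  identity) is included only to make the definition total.\<close>

fun conv_power :: "('a, 'b) monoid_scheme \<Rightarrow> ('a \<Rightarrow> real) \<Rightarrow> nat \<Rightarrow> 'a \<Rightarrow> real" where
  "conv_power G Q 0 = (\<lambda>s. if s = \<one>\<^bsub>G\<^esub> then 1 else 0)"
| "conv_power G Q (Suc 0) = Q"
| "conv_power G Q (Suc (Suc k)) =
     (\<lambda>s. \<Sum>t\<in>carrier G. Q (s \<otimes>\<^bsub>G\<^esub> inv\<^bsub>G\<^esub> t) * conv_power G Q (Suc k) t)"

text \<open>Meaningful for finite \<open>S\<close> only.\<close>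

definition tv_dist :: "'a set \<Rightarrow> ('a \<Rightarrow> real) \<Rightarrow> ('a \<Rightarrow> real) \<Rightarrow> real" where
  "tv_dist S P1 P2 = Max ((\<lambda>A. \<bar>(\<Sum>s\<in>A. P1 s) - (\<Sum>s\<in>A. P2 s)\<bar>) ` Pow S)"

lemma carrier_Dic: "carrier (Dic n) = {0..<2 * int n} \<times> UNIV"
  and mult_Dic: "s \<otimes>\<^bsub>Dic n\<^esub> t = dic_mult n s t"
  and one_Dic: "\<one>\<^bsub>Dic n\<^esub> = (0, False)"
  by (simp_all add: Dic_def)

lemma card_Dic: "card (carrier (Dic n)) = 4 * n"
  by (simp add: carrier_Dic card_cartesian_product nat_mult_distrib)

lemma mod_diff_add_eq:
  "(k mod N - m + i) mod N = (k - m + i) mod (N::int)"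
  "(k - m mod N + i) mod N = (k - m + i) mod (N::int)"
  by (metis mod_add_left_eq mod_diff_left_eq, metis mod_add_left_eq mod_diff_right_eq)

lemma dic_mult_assoc:
  "dic_mult n (dic_mult n r s) t = dic_mult n r (dic_mult n s t)"
proof -
  have shift: "(k - (i + int n)) mod (2 * int n) = (k - i + int n) mod (2 * int n)" for k i
    by (metis (no_types, lifting) add_diff_cancel_right' diff_add_eq mod_add_self2 mult_2
        diff_diff_eq add.assoc)
  obtain k e where r: "r = (k, e)" by fastforce
  obtain l f where s: "s = (l, f)" by fastforce
  obtain m g where t: "t = (m, g)" by fastforce
  have two: "(k - l + int n + m) mod (2 * int n) = (k - (l - m + int n)) mod (2 * int n)"
    using shift[of k "l - m"] by (simp add: algebra_simps)
  have three: "(k - (l - m + int n) + int n) mod (2 * int n) = (k - l + m) mod (2 * int n)"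
    by (simp add: algebra_simps)
  show ?thesis
    unfolding r s t using two three
    by (cases e; cases f; cases g; simp add: mod_diff_add_eq mod_simps; simp add: algebra_simps)
qed

lemma group_Dic:
  assumes "n \<ge> 1"
  shows "group (Dic n)"
proof (rule groupI)
  show "s \<otimes>\<^bsub>Dic n\<^esub> t \<in> carrier (Dic n)" for s t
    using assms by (cases "(n, s, t)" rule: dic_mult.cases) (auto simp: mult_Dic carrier_Dic)
  show "\<one>\<^bsub>Dic n\<^esub> \<in> carrier (Dic n)"
    using assms by (simp add: one_Dic carrier_Dic)
  show "r \<otimes>\<^bsub>Dic n\<^esub> s \<otimes>\<^bsub>Dic n\<^esub> t = r \<otimes>\<^bsub>Dic n\<^esub> (s \<otimes>\<^bsub>Dic n\<^esub> t)" for r s t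
    by (simp only: mult_Dic dic_mult_assoc)
  show "\<one>\<^bsub>Dic n\<^esub> \<otimes>\<^bsub>Dic n\<^esub> s = s" if "s \<in> carrier (Dic n)" for s
    using that by (cases s; cases "snd s") (auto simp: one_Dic mult_Dic carrier_Dic)
  show "\<exists>t\<in>carrier (Dic n). t \<otimes>\<^bsub>Dic n\<^esub> s = \<one>\<^bsub>Dic n\<^esub>" if "s \<in> carrier (Dic n)" for s
  proof (cases s)
    case (Pair k e)
    have "((- k) mod (2 * int n), False) \<otimes>\<^bsub>Dic n\<^esub> (k, False) = \<one>\<^bsub>Dic n\<^esub>"
      by (simp add: mult_Dic one_Dic mod_simps)
    moreover have "((k + int n) mod (2 * int n), True) \<otimes>\<^bsub>Dic n\<^esub> (k, True) = \<one>\<^bsub>Dic n\<^esub>"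
      by (simp add: mult_Dic one_Dic mod_diff_add_eq)
    ultimately show ?thesis
      using Pair assms by (cases e) (force simp: carrier_Dic)+
  qed
qed

lemma dic_a_pow: "dic_a [^]\<^bsub>Dic n\<^esub> (i::nat) = (int i mod (2 * int n), False)"
  by (induction i) (simp_all add: nat_pow_def dic_a_def one_Dic mult_Dic mod_simps algebra_simps)

lemma Dic_relations:
  assumes "n \<ge> 1"
  shows "dic_a \<in> carrier (Dic n)" "dic_x \<in> carrier (Dic n)"
    and "dic_a [^]\<^bsub>Dic n\<^esub> (2 * n) = \<one>\<^bsub>Dic n\<^esub>"
    and "dic_x \<otimes>\<^bsub>Dic n\<^esub> dic_x = dic_a [^]\<^bsub>Dic n\<^esub> n"
    and "dic_x \<otimes>\<^bsub>Dic n\<^esub> dic_a \<otimes>\<^bsub>Dic n\<^esub> inv\<^bsub>Dic n\<^esub> dic_x = inv\<^bsub>Dic n\<^esub> dic_a"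
proof -
  interpret group "Dic n" using group_Dic[OF assms] .
  show a: "dic_a \<in> carrier (Dic n)" and x: "dic_x \<in> carrier (Dic n)"
    using assms by (auto simp: dic_a_def dic_x_def carrier_Dic)
  show "dic_a [^]\<^bsub>Dic n\<^esub> (2 * n) = \<one>\<^bsub>Dic n\<^esub>"
    by (simp add: dic_a_pow one_Dic)
  show "dic_x \<otimes>\<^bsub>Dic n\<^esub> dic_x = dic_a [^]\<^bsub>Dic n\<^esub> n"
    by (simp add: dic_a_pow dic_x_def mult_Dic)
  have "dic_a \<otimes>\<^bsub>Dic n\<^esub> (dic_x \<otimes>\<^bsub>Dic n\<^esub> dic_a) = dic_x"
    by (simp add: dic_a_def dic_x_def mult_Dic mod_simps)
  then have "dic_x \<otimes>\<^bsub>Dic n\<^esub> dic_a = inv\<^bsub>Dic n\<^esub> dic_a \<otimes>\<^bsub>Dic n\<^esub> dic_x"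
    using a x by (metis inv_solve_left m_closed)
  then show "dic_x \<otimes>\<^bsub>Dic n\<^esub> dic_a \<otimes>\<^bsub>Dic n\<^esub> inv\<^bsub>Dic n\<^esub> dic_x = inv\<^bsub>Dic n\<^esub> dic_a"
    using a x by (simp add: m_assoc)
qed

text \<open>Every element is $a^i$ or $a^i x$ with $0 \le i < 2n$.\<close>

lemma Dic_elements:
  assumes "n \<ge> 1"
  shows "carrier (Dic n) = (\<lambda>i. dic_a [^]\<^bsub>Dic n\<^esub> i) ` {..<2 * n}
           \<union> (\<lambda>i. dic_a [^]\<^bsub>Dic n\<^esub> i \<otimes>\<^bsub>Dic n\<^esub> dic_x) ` {..<2 * n}"
proof -
  have "{0..<2 * int n} = int ` {..<2 * n}"
    by (simp add: image_int_atLeastLessThan lessThan_atLeast0)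
  then have "carrier (Dic n) = (\<lambda>i. (int i, False)) ` {..<2 * n} \<union> (\<lambda>i. (int i, True)) ` {..<2 * n}"
    by (auto simp: carrier_Dic UNIV_bool)
  moreover have "int i mod (2 * int n) = int i" if "i < 2 * n" for i
    using that by simp
  ultimately show ?thesis
    by (simp add: dic_a_pow dic_x_def mult_Dic cong: image_cong_simp)
qed

end

theory Submission
  imports Defs
begin

text \<open>The step distribution is symmetric, so convolution by it is self-adjoint and
  $\sum_s Q^{*k}(s)^2 = Q^{*2k}(1)$. Expanding the convolution powers in the cosines
  $\cos(\pi m j/n)$ makes this a sum over the spectrum, whose nontrivial even frequencies
  contribute the numbers $\cos^{4k}(\pi j/(2n))$ for $1 \le j < n$, each twice; the
  Cauchy-Schwarz inequality and $\cos x \le e^{-x^2/2}$ give the upper bound. For the lower bound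
  test against the eigenfunction $\pm\cos(\pi(n-1)j/n)$, which has mean zero and
  eigenvalue $-\cos^2(\pi/(2n))$.\<close>

section \<open>Total variation as half of an l1 distance\<close>

text \<open>The difference of the two functions sums to zero, so its sums over a set and over the
  complement are opposite and each takes at most half of the absolute mass.\<close>

lemma tv_dist_eq_half_sum:
  fixes P1 P2 :: "'a \<Rightarrow> real"
  assumes S: "finite S" and mass: "sum P1 S = sum P2 S"
  shows "tv_dist S P1 P2 = (\<Sum>s\<in>S. \<bar>P1 s - P2 s\<bar>) / 2"
proof -
  define D where "D s = P1 s - P2 s" for s
  have diff: "(\<Sum>s\<in>A. P1 s) - (\<Sum>s\<in>A. P2 s) = sum D A" for A
    by (simp add: D_def sum_subtractf)
  have split: "sum f S = sum f A + sum f (S - A)" if "A \<subseteq> S" for f :: "'a \<Rightarrow> real" and A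
    using sum.subset_diff[OF that S] by (simp add: add.commute)
  have zero: "sum D S = 0"
    using mass diff[of S] by simp
  have upper: "\<bar>sum D A\<bar> \<le> (\<Sum>s\<in>S. \<bar>D s\<bar>) / 2" if "A \<subseteq> S" for A
    using split[OF that, of D] split[OF that, of "\<lambda>s. \<bar>D s\<bar>"] zero
      sum_abs[of D A] sum_abs[of D "S - A"] by linarith
  \<comment> \<open>The set where the difference is positive has no cancellation, so it attains the
    maximum.\<close>
  define A where "A = {s \<in> S. D s > 0}"
  have A: "A \<subseteq> S" by (auto simp: A_def)
  have "(\<Sum>s\<in>A. \<bar>D s\<bar>) = sum D A" "(\<Sum>s\<in>S - A. \<bar>D s\<bar>) = - sum D (S - A)"
    unfolding sum_negf[symmetric] by (rule sum.cong; auto simp: A_def)+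
  then have "\<bar>sum D A\<bar> = (\<Sum>s\<in>S. \<bar>D s\<bar>) / 2"
    using split[OF A, of D] split[OF A, of "\<lambda>s. \<bar>D s\<bar>"] zero sum_abs[of D A] upper[OF A] by linarith
  then have "Max ((\<lambda>A. \<bar>sum D A\<bar>) ` Pow S) = (\<Sum>s\<in>S. \<bar>D s\<bar>) / 2"
    using S A upper by (intro Max_eqI) (auto intro!: image_eqI[of _ _ A])
  then show ?thesis
    by (simp add: tv_dist_def diff D_def)
qed

section \<open>Convolution powers on a finite group\<close>

context group
begin

lemma sum_translate:
  assumes "finite (carrier G)" "t \<in> carrier G"
  shows "(\<Sum>s\<in>carrier G. f (s \<otimes> inv t) * h s) = (\<Sum>q\<in>carrier G. f q * h (q \<otimes> t) :: real)"
  by (rule sum.reindex_bij_witness[where i = "\<lambda>q. q \<otimes> t" and j = "\<lambda>s. s \<otimes> inv t"])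
    (use assms in \<open>auto simp: m_assoc\<close>)

text \<open>Taking the point mass as power 0 makes the recursion uniform, so inductions can start at
  0.\<close>

lemma conv_power_Suc:
  assumes "finite (carrier G)" "s \<in> carrier G"
  shows "conv_power G Q (Suc k) s = (\<Sum>t\<in>carrier G. Q (s \<otimes> inv t) * conv_power G Q k t)"
proof (cases k)
  case 0
  have "(\<Sum>t\<in>carrier G. Q (s \<otimes> inv t) * conv_power G Q 0 t)
      = (\<Sum>t\<in>carrier G. if t = \<one> then Q (s \<otimes> inv t) else 0)"
    by (rule sum.cong) auto
  then show ?thesis
    using assms 0 by simp
qed simp

text \<open>Exchanging the two sums moves one factor \<open>Q\<close> onto \<open>h\<close>, which
  costs a factor \<open>c\<close>. Constant \<open>h\<close> gives total mass; a cosine gives the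
  lower bound.\<close>

lemma sum_conv_power_eigenfunction:
  assumes fin: "finite (carrier G)"
    and eigen: "\<And>t. t \<in> carrier G \<Longrightarrow> (\<Sum>s\<in>carrier G. Q (s \<otimes> inv t) * h s) = c * h t"
  shows "(\<Sum>s\<in>carrier G. conv_power G Q k s * h s) = c ^ k * h \<one>"
proof (induction k)
  case 0
  have "(\<Sum>s\<in>carrier G. conv_power G Q 0 s * h s) = (\<Sum>s\<in>carrier G. if s = \<one> then h s else 0)"
    by (rule sum.cong) auto
  then show ?case using fin by simp
next
  case (Suc k)
  have "(\<Sum>s\<in>carrier G. conv_power G Q (Suc k) s * h s)
      = (\<Sum>s\<in>carrier G. \<Sum>t\<in>carrier G. Q (s \<otimes> inv t) * conv_power G Q k t * h s)"
    using fin by (intro sum.cong refl) (simp only: conv_power_Suc sum_distrib_right)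
  also have "\<dots> = (\<Sum>t\<in>carrier G. conv_power G Q k t * (\<Sum>s\<in>carrier G. Q (s \<otimes> inv t) * h s))"
    by (subst sum.swap) (simp add: sum_distrib_left mult.assoc mult.left_commute)
  also have "\<dots> = c * (\<Sum>t\<in>carrier G. conv_power G Q k t * h t)"
    using eigen by (simp add: sum_distrib_left mult.left_commute cong: sum.cong)
  finally show ?case using Suc by simp
qed

text \<open>For symmetric \<open>Q\<close> the kernel \<open>Q (s \<otimes> inv t)\<close> is
  symmetric in \<open>s\<close> and \<open>t\<close>, so convolution by \<open>Q\<close> is
  self-adjoint.\<close>

lemma sum_conv_power_shift:
  assumes fin: "finite (carrier G)" and symm: "\<And>s. s \<in> carrier G \<Longrightarrow> Q (inv s) = Q s"
  shows "(\<Sum>s\<in>carrier G. conv_power G Q (Suc i) s * conv_power G Q j s)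
       = (\<Sum>s\<in>carrier G. conv_power G Q i s * conv_power G Q (Suc j) s)"
proof -
  have Q: "Q (s \<otimes> inv t) = Q (t \<otimes> inv s)" if "s \<in> carrier G" "t \<in> carrier G" for s t
    using symm[of "s \<otimes> inv t"] that by (simp add: inv_mult_group)
  have "(\<Sum>s\<in>carrier G. conv_power G Q (Suc i) s * conv_power G Q j s)
      = (\<Sum>s\<in>carrier G. \<Sum>t\<in>carrier G. Q (s \<otimes> inv t) * conv_power G Q i t * conv_power G Q j s)"
    using fin by (intro sum.cong refl) (simp only: conv_power_Suc sum_distrib_right)
  also have "\<dots> = (\<Sum>t\<in>carrier G. \<Sum>s\<in>carrier G. Q (t \<otimes> inv s) * conv_power G Q i t * conv_power G Q j s)"
    by (subst sum.swap) (auto intro!: sum.cong simp: Q)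
  also have "\<dots> = (\<Sum>t\<in>carrier G. conv_power G Q i t * conv_power G Q (Suc j) t)"
    using fin by (intro sum.cong refl) (simp only: conv_power_Suc sum_distrib_left mult_ac)
  finally show ?thesis .
qed

text \<open>Factors are shifted to the left one at a time until the right one is the point mass,
  which evaluates the other at the identity.\<close>

lemma sum_conv_power_mult:
  assumes fin: "finite (carrier G)" and symm: "\<And>s. s \<in> carrier G \<Longrightarrow> Q (inv s) = Q s"
  shows "(\<Sum>s\<in>carrier G. conv_power G Q i s * conv_power G Q j s) = conv_power G Q (i + j) \<one>"
proof (induction j arbitrary: i)
  case 0
  have "(\<Sum>s\<in>carrier G. conv_power G Q i s * conv_power G Q 0 s)
      = (\<Sum>s\<in>carrier G. if s = \<one> then conv_power G Q i s else 0)"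
    by (rule sum.cong) auto
  then show ?case using fin by simp
next
  case (Suc j)
  show ?case
    using Suc[of "Suc i"] sum_conv_power_shift[of Q i j, OF assms] by simp
qed

lemma sum_conv_power:
  assumes fin: "finite (carrier G)" and mass: "sum Q (carrier G) = 1"
  shows "sum (conv_power G Q k) (carrier G) = 1"
proof -
  have "(\<Sum>s\<in>carrier G. Q (s \<otimes> inv t) * 1) = 1 * 1" if "t \<in> carrier G" for t
    using sum_translate[OF fin that, of Q "\<lambda>_. 1"] mass by simp
  from sum_conv_power_eigenfunction[OF fin this] show ?thesis by simp
qed

text \<open>Cauchy-Schwarz passes from l1 to l2. The squared l2 distance to uniform is a return
  probability minus \<open>1 / N\<close>, so only the value at the identity has to be
  computed.\<close>

lemma tv_dist_conv_power_upper:
  assumes fin: "finite (carrier G)" and mass: "sum Q (carrier G) = 1"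
    and symm: "\<And>s. s \<in> carrier G \<Longrightarrow> Q (inv s) = Q s"
    and U: "\<And>s. s \<in> carrier G \<Longrightarrow> U s = 1 / card (carrier G)"
  shows "4 * (tv_dist (carrier G) (conv_power G Q k) U)\<^sup>2
           \<le> card (carrier G) * conv_power G Q (2 * k) \<one> - 1"
proof -
  let ?C = "carrier G" and ?P = "conv_power G Q k"
  define N where "N = real (card ?C)"
  have N: "N > 0"
    unfolding N_def using fin by (auto simp: card_gt_0_iff)
  have sum_U: "sum U ?C = 1"
    using N by (simp add: U N_def)
  have sum_P: "sum ?P ?C = 1"
    by (rule sum_conv_power[OF fin mass])
  have "(\<Sum>s\<in>?C. \<bar>?P s - U s\<bar>)\<^sup>2 \<le> N * (\<Sum>s\<in>?C. (?P s - U s)\<^sup>2)"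
    using Cauchy_Schwarz_ineq_sum[of "\<lambda>_. 1" "\<lambda>s. \<bar>?P s - U s\<bar>" ?C] by (simp add: N_def)
  also have "(\<Sum>s\<in>?C. (?P s - U s)\<^sup>2) = (\<Sum>s\<in>?C. ?P s * ?P s - 2 / N * ?P s + 1 / N * U s)"
    by (rule sum.cong) (auto simp: U N_def power2_eq_square algebra_simps)
  also have "\<dots> = (\<Sum>s\<in>?C. ?P s * ?P s) - 2 / N * sum ?P ?C + 1 / N * sum U ?C"
    by (simp only: sum.distrib sum_subtractf sum_distrib_left)
  also have "\<dots> = conv_power G Q (2 * k) \<one> - 1 / N"
    using sum_conv_power_mult[of Q k k, OF fin symm] by (simp add: sum_P sum_U flip: mult_2)
  finally have "(\<Sum>s\<in>?C. \<bar>?P s - U s\<bar>)\<^sup>2 \<le> N * conv_power G Q (2 * k) \<one> - 1"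
    using N by (simp add: algebra_simps)
  moreover have "(\<Sum>s\<in>?C. \<bar>?P s - U s\<bar>) = 2 * tv_dist ?C ?P U"
    using tv_dist_eq_half_sum[OF fin, of ?P U] sum_P sum_U by simp
  ultimately show ?thesis
    by (simp add: N_def power_mult_distrib)
qed

text \<open>Pairing with \<open>h\<close> kills the uniform part and leaves \<open>c ^ k\<close>,
  while \<open>h\<close> bounded by 1 makes the pairing at most the l1 distance.\<close>

lemma tv_dist_conv_power_lower:
  assumes fin: "finite (carrier G)" and mass: "sum Q (carrier G) = 1"
    and U: "\<And>s. s \<in> carrier G \<Longrightarrow> U s = 1 / card (carrier G)"
    and eigen: "\<And>t. t \<in> carrier G \<Longrightarrow> (\<Sum>s\<in>carrier G. Q (s \<otimes> inv t) * h s) = c * h t"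
    and mean: "sum h (carrier G) = 0" and unit: "h \<one> = 1"
    and bound: "\<And>s. s \<in> carrier G \<Longrightarrow> \<bar>h s\<bar> \<le> 1"
  shows "\<bar>c\<bar> ^ k / 2 \<le> tv_dist (carrier G) (conv_power G Q k) U"
proof -
  let ?C = "carrier G" and ?P = "conv_power G Q k"
  have "(\<Sum>s\<in>?C. U s * h s) = sum h ?C / card ?C"
    by (simp add: U sum_divide_distrib)
  then have "(\<Sum>s\<in>?C. (?P s - U s) * h s) = c ^ k"
    using sum_conv_power_eigenfunction[OF fin eigen] mean unit
    by (simp add: left_diff_distrib sum_subtractf)
  then have "\<bar>c\<bar> ^ k = \<bar>\<Sum>s\<in>?C. (?P s - U s) * h s\<bar>"
    by (simp add: power_abs)
  also have "\<dots> \<le> (\<Sum>s\<in>?C. \<bar>?P s - U s\<bar> * \<bar>h s\<bar>)"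
    by (metis (no_types, lifting) abs_mult sum.cong sum_abs)
  also have "\<dots> \<le> (\<Sum>s\<in>?C. \<bar>?P s - U s\<bar>)"
    using bound by (intro sum_mono mult_left_le) auto
  finally show ?thesis
  proof (subst tv_dist_eq_half_sum[OF fin])
    have "card ?C > 0" using fin by (auto simp: card_gt_0_iff)
    then show "sum ?P ?C = sum U ?C"
      by (simp add: U sum_conv_power[OF fin mass])
  qed simp
qed

end

section \<open>Taylor estimates for cosine and exponential\<close>

text \<open>The Maclaurin remainder of order 6 is \<open>- cos t * x^6 / 720\<close> with
  \<open>t\<close> no larger than \<open>x\<close> in absolute value, hence \<open>cos t\<close>
  lies in [0, 1].\<close>

lemma cos_bounds:
  fixes x :: real
  assumes "0 \<le> x" "x \<le> pi / 2"
  shows "1 - x^2 / 2 + x^4 / 24 - x^6 / 720 \<le> cos x" "cos x \<le> 1 - x^2 / 2 + x^4 / 24"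
proof -
  obtain t where t: "\<bar>t\<bar> \<le> \<bar>x\<bar>"
    and eq: "cos x = (\<Sum>m<6. cos_coeff m * x ^ m) + cos (t + 1/2 * real 6 * pi) / fact 6 * x ^ 6"
    using Maclaurin_cos_expansion[of x 6] by blast
  have "cos (t + 1/2 * real 6 * pi) = - cos t"
    using cos_periodic[of "t + pi"] by (simp add: algebra_simps)
  with eq have *: "cos x = 1 - x^2 / 2 + x^4 / 24 - cos t * x^6 / 720"
    by (simp add: eval_nat_numeral cos_coeff_Suc sin_coeff_Suc)
  have "0 \<le> cos t" "cos t \<le> 1"
    using t assms by (auto intro!: cos_ge_zero)
  then have "0 \<le> cos t * x^6" "cos t * x^6 \<le> 1 * x^6"
    using mult_right_mono[of "cos t" 1 "x^6"] by simp_all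
  with * show "1 - x^2 / 2 + x^4 / 24 - x^6 / 720 \<le> cos x" "cos x \<le> 1 - x^2 / 2 + x^4 / 24"
    by auto
qed

lemma exp_minus_bounds:
  fixes y :: real
  assumes "0 \<le> y"
  shows "1 - y + y^2 / 2 - y^3 / 6 \<le> exp (- y)" "exp (- y) \<le> 1 - y + y^2 / 2"
proof -
  obtain t where "exp (- y) = (\<Sum>m<4. (- y) ^ m / fact m) + exp t / fact 4 * (- y) ^ 4"
    using Maclaurin_exp_le[of "- y" 4] by blast
  then have "exp (- y) = 1 - y + y^2 / 2 - y^3 / 6 + exp t / 24 * y ^ 4"
    by (simp add: eval_nat_numeral fact_numeral)
  then show "1 - y + y^2 / 2 - y^3 / 6 \<le> exp (- y)" by simp
  obtain t where "exp (- y) = (\<Sum>m<3. (- y) ^ m / fact m) + exp t / fact 3 * (- y) ^ 3"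
    using Maclaurin_exp_le[of "- y" 3] by blast
  then have "exp (- y) = 1 - y + y^2 / 2 - exp t / 6 * y ^ 3"
    by (simp add: eval_nat_numeral fact_numeral)
  then show "exp (- y) \<le> 1 - y + y^2 / 2" using assms by simp
qed

text \<open>The quartic coefficients 1/8 and 1/24 differ by 1/12, just enough to absorb
  \<open>x^6 / 48\<close> when \<open>x^2 \<le> 4\<close>.\<close>

lemma cos_le_exp:
  fixes x :: real
  assumes "0 \<le> x" "x \<le> pi / 2"
  shows "cos x \<le> exp (- (x^2 / 2))"
proof -
  have "x\<^sup>2 \<le> 2\<^sup>2"
    using assms pi_less_4 by (intro power_mono) auto
  then have "x^4 * x^2 \<le> x^4 * 4"
    by (intro mult_left_mono) auto
  moreover have "(x^2 / 2)^2 / 2 - (x^2 / 2)^3 / 6 = x^4 / 8 - x^4 * x^2 / 48"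
    by (simp add: power_divide flip: power_mult power_add)
  ultimately have "x^4 / 24 \<le> (x^2 / 2)^2 / 2 - (x^2 / 2)^3 / 6"
    by simp
  then show ?thesis
    using cos_bounds(2)[OF assms] exp_minus_bounds(1)[of "x^2 / 2"] by simp
qed

text \<open>The exponent agrees with the expansion of \<open>- ln (cos x)\<close> up to order 4; the
  term \<open>x^5 / 25\<close> absorbs all higher orders on this range.\<close>

lemma exp_le_cos:
  fixes x :: real
  assumes "0 \<le> x" "x \<le> 1 / 2"
  shows "exp (- (x^2 / 2 + x^4 / 12 + x^5 / 25)) \<le> cos x"
proof -
  define y where "y = x^2 / 2 + x^4 / 12 + x^5 / 25"
  \<comment> \<open>The part of \<open>y\<close> beyond the quadratic term, kept apart to expand
    \<open>y^2\<close>.\<close>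
  define w where "w = x^4 / 12 + x^5 / 25"
  have half: "x ^ Suc m \<le> x ^ m / 2" for m
    using mult_left_mono[OF assms(2), of "x ^ m"] assms(1) by (simp add: mult.commute)
  have nonneg: "0 \<le> x^4" "0 \<le> x^5" and "x^5 \<le> x^4 / 2"
    using assms half[of 4] by simp_all
  then have w: "0 \<le> w" "w \<le> x^4 / 9"
    unfolding w_def by linarith+
  have "x^2 * w \<le> x^6 / 9" "w^2 \<le> x^8 / 81"
    using mult_left_mono[OF w(2), of "x^2"] power_mono[OF w(2) w(1), of 2]
    by (simp_all add: power_divide flip: power_add power_mult)
  moreover have "y^2 / 2 = x^4 / 8 + x^2 * w / 2 + w^2 / 2"
    by (simp add: y_def w_def power2_eq_square field_simps eval_nat_numeral)
  moreover have "x^8 \<le> x^7 / 2" "x^7 \<le> x^6 / 2" "x^6 \<le> x^5 / 2"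
    using half[of 7] half[of 6] half[of 5] by simp_all
  ultimately have "y^2 / 2 + x^6 / 720 \<le> x^4 / 8 + x^5 / 25"
    using nonneg(2) by linarith
  then have "1 - y + y^2 / 2 \<le> cos x"
    using cos_bounds(1)[of x] assms pi_gt3 by (simp add: y_def)
  then show ?thesis
    using exp_minus_bounds(2)[of y] assms by (simp add: y_def)
qed

section \<open>A Gaussian sum and a cosine sum\<close>

text \<open>Since \<open>m^2 \<ge> 1 + 3 * (m - 1)\<close> for positive integers, a geometric series
  of ratio \<open>exp (- (3 * b))\<close> dominates. Odd and even \<open>m\<close> are paired
  because they will come from sines and cosines respectively.\<close>

lemma sum_exp_even_odd_squares_le:
  fixes b :: real
  assumes "b > 0"
  shows "(\<Sum>i<p. exp (- b * (real (2 * i + 1))\<^sup>2) + exp (- b * (real (2 * (i + 1)))\<^sup>2))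
           \<le> exp (- b) / (1 - exp (- (3 * b)))"
proof -
  define r where "r = exp (- (3 * b))"
  have r: "0 < r" "r < 1" using assms by (auto simp: r_def)
  have bound: "exp (- b * (real (Suc j))\<^sup>2) \<le> exp (- b) * r ^ j" for j
  proof -
    have "1 + 3 * real j \<le> (real (Suc j))\<^sup>2"
      by (cases j) (auto simp: power2_eq_square algebra_simps)
    then have "b * (1 + 3 * real j) \<le> b * (real (Suc j))\<^sup>2"
      using assms by (intro mult_left_mono) auto
    then show ?thesis
      by (simp add: r_def algebra_simps flip: exp_add exp_of_nat_mult)
  qed
  have "(\<Sum>i<p. exp (- b * (real (2 * i + 1))\<^sup>2) + exp (- b * (real (2 * (i + 1)))\<^sup>2))
      \<le> (\<Sum>i<p. exp (- b) * r ^ (2 * i) + exp (- b) * r ^ (2 * i + 1))"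
    using bound[of "2 * _"] bound[of "2 * _ + 1"] by (intro sum_mono add_mono) (auto simp: algebra_simps)
  also have "\<dots> = exp (- b) * (\<Sum>j<2 * p. r ^ j)"
    by (induction p) (auto simp: algebra_simps)
  also have "\<dots> \<le> exp (- b) * (1 / (1 - r))"
    using r by (intro mult_left_mono) (auto simp: sum_gp_strict field_simps)
  finally show ?thesis by (simp add: r_def)
qed

text \<open>Real part of a geometric sum over the powers of a nontrivial root of unity of order
  dividing \<open>2 * n\<close>.\<close>

lemma sum_cos_mult_eq_0:
  fixes j n :: nat
  assumes "0 < j" "j < 2 * n"
  shows "(\<Sum>m<2 * n. cos (real m * (pi * real j / real n))) = 0"
proof -
  define x where "x = pi * real j / real n"
  have x: "0 < x" "x < 2 * pi" "real (2 * n) * x = 2 * pi * real j"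
    using assms by (auto simp: x_def field_simps)
  have "cis x \<noteq> 1"
  proof
    assume "cis x = 1"
    then obtain i :: int where "x = i * 2 * pi"
      using cos_one_2pi_int[of x] by (auto simp: complex_eq_iff)
    then have "0 < i" "i < 1" using x by (auto simp: zero_less_mult_iff)
    then show False by simp
  qed
  moreover have "cis x ^ (2 * n) = 1"
    by (simp only: Complex.DeMoivre x(3)) (simp add: cis_multiple_2pi)
  ultimately have "(\<Sum>m<2 * n. cis x ^ m) = 0"
    by (simp add: sum_gp_strict)
  then have "(\<Sum>m<2 * n. Re (cis x ^ m)) = 0"
    by (metis Re_sum zero_complex.sel(1))
  then show ?thesis
    by (simp add: Complex.DeMoivre x_def)
qed

section \<open>The step distribution on the dicyclic group\<close>

text \<open>For \<open>n \<ge> 2\<close> the four support points are distinct, so their masses add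
  up to 1.\<close>

locale dicyclic_walk =
  fixes n :: nat and Q :: "int \<times> bool \<Rightarrow> real"
  assumes n_ge_2: "n \<ge> 2"
    and Q: "Q s = (if s \<in> {(1, False), (2 * int n - 1, False), (0, True), (int n, True)} then 1 / 4 else 0)"
begin

sublocale group "Dic n"
  using n_ge_2 by (intro group_Dic) simp

lemma finite_carrier: "finite (carrier (Dic n))"
  by (simp add: carrier_Dic)

lemma sum_Q: "(\<Sum>q\<in>carrier (Dic n). Q q * h q)
    = (h (1, False) + h (2 * int n - 1, False) + h (0, True) + h (int n, True)) / 4"
proof -
  let ?S = "{(1, False), (2 * int n - 1, False), (0, True), (int n, True)}"
  have "(\<Sum>q\<in>carrier (Dic n). Q q * h q) = (\<Sum>q\<in>?S. Q q * h q)"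
    using n_ge_2 by (intro sum.mono_neutral_right finite_carrier) (auto simp: carrier_Dic Q)
  also have "\<dots> = (\<Sum>q\<in>?S. h q) / 4"
    unfolding sum_divide_distrib by (intro sum.cong) (auto simp: Q)
  finally show ?thesis
    using n_ge_2 by (simp add: add.assoc)
qed

lemma mass_Q: "sum Q (carrier (Dic n)) = 1"
  using sum_Q[of "\<lambda>_. 1"] by simp

text \<open>Inversion exchanges $a$ with $a^{2n-1}$ and $x$ with $a^n x$.\<close>

lemma Q_inv:
  assumes "s \<in> carrier (Dic n)"
  shows "Q (inv\<^bsub>Dic n\<^esub> s) = Q s"
proof (cases s)
  case (Pair k b)
  with assms have k: "0 \<le> k" "k < 2 * int n" by (auto simp: carrier_Dic)
  show ?thesis
  proof (cases b)
    case True
    have "inv\<^bsub>Dic n\<^esub> s = ((k + int n) mod (2 * int n), True)"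
      using Pair True k by (intro inv_equality) (auto simp: mult_Dic one_Dic carrier_Dic mod_diff_add_eq)
    also have "(k + int n) mod (2 * int n) = (if k < int n then k + int n else k - int n)"
      using k mod_pos_pos_trivial[of "k - int n" "2 * int n"] mod_add_self2[of "k - int n" "2 * int n"]
      by (auto simp: add.commute)
    finally show ?thesis using Pair True k by (auto simp: Q)
  next
    case False
    have "inv\<^bsub>Dic n\<^esub> s = ((- k) mod (2 * int n), False)"
      using Pair False k by (intro inv_equality) (auto simp: mult_Dic one_Dic carrier_Dic mod_simps)
    also have "(- k) mod (2 * int n) = (if k = 0 then 0 else 2 * int n - k)"
      using k by (simp add: zmod_zminus1_eq_if)
    finally show ?thesis using Pair False k n_ge_2 by (auto simp: Q)
  qed
qed

lemma Q_mult_inv_commute: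
  assumes "s \<in> carrier (Dic n)" "t \<in> carrier (Dic n)"
  shows "Q (s \<otimes>\<^bsub>Dic n\<^esub> inv\<^bsub>Dic n\<^esub> t) = Q (t \<otimes>\<^bsub>Dic n\<^esub> inv\<^bsub>Dic n\<^esub> s)"
  using Q_inv[of "s \<otimes>\<^bsub>Dic n\<^esub> inv\<^bsub>Dic n\<^esub> t"] assms by (simp add: inv_mult_group)

lemma sum_Q_translate:
  assumes "(j, b) \<in> carrier (Dic n)"
  shows "(\<Sum>s\<in>carrier (Dic n). Q (s \<otimes>\<^bsub>Dic n\<^esub> inv\<^bsub>Dic n\<^esub> (j, b)) * h s)
    = (h ((j + 1) mod (2 * int n), b) + h ((j - 1) mod (2 * int n), b)
       + h ((- j) mod (2 * int n), \<not> b) + h ((int n - j) mod (2 * int n), \<not> b)) / 4"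
proof -
  have "(2 * int n - 1 + j) mod (2 * int n) = (j - 1) mod (2 * int n)"
    using mod_add_self2[of "j - 1" "2 * int n"] by (simp add: algebra_simps)
  moreover have "(int n - j + int n) mod (2 * int n) = (- j) mod (2 * int n)"
    using mod_add_self2[of "- j" "2 * int n"] by (simp add: algebra_simps)
  ultimately show ?thesis
    unfolding sum_translate[OF finite_carrier assms] sum_Q
    by (cases b) (simp_all add: mult_Dic add.commute)
qed

section \<open>Cosine expansion of the convolution powers\<close>

text \<open>The real part of a character of the cyclic subgroup. Reflections preserve it up to sign,
  so no sines are needed.\<close>

definition C :: "nat \<Rightarrow> int \<Rightarrow> real" where
  "C m j = cos (pi * real m * real_of_int j / real n)"

lemma C_0 [simp]: "C m 0 = 1" "C 0 j = 1" by (simp_all add: C_def)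

lemma C_minus [simp]: "C m (- j) = C m j" by (simp add: C_def)

lemma abs_C_le_1: "\<bar>C m j\<bar> \<le> 1" by (simp add: C_def)

lemma C_mod [simp]: "C m (j mod (2 * int n)) = C m j"
proof -
  have r: "real_of_int (j mod (2 * int n)) = real_of_int j - 2 * real n * real_of_int (j div (2 * int n))"
    by (simp flip: minus_mult_div_eq_mod)
  have "pi * real m * real_of_int (j mod (2 * int n)) / real n
      = pi * real m * real_of_int j / real n - 2 * pi * real_of_int (int m * (j div (2 * int n)))"
    unfolding r using n_ge_2 by (simp add: field_simps)
  then show ?thesis
    by (simp only: C_def cos_diff cos_int_2pin sin_int_2pin)
qed

lemma C_neighbours: "C m (j + 1) + C m (j - 1) = 2 * C m 1 * C m j"
  by (simp add: C_def distrib_left right_diff_distrib add_divide_distrib diff_divide_distrib cos_add cos_diff)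

text \<open>This sign is why the steps $x$ and $a^n x$ reinforce each other at even frequencies and
  cancel at odd ones.\<close>

lemma C_reflect [simp]: "C m (int n - j) = (- 1) ^ m * C m j"
proof -
  have "pi * real m * real_of_int (int n - j) / real n = real m * pi - pi * real m * real_of_int j / real n"
    using n_ge_2 by (simp add: field_simps)
  then show ?thesis
    by (simp only: C_def cos_diff cos_npi sin_npi)
qed

text \<open>With $c = \cos(\pi m/n)$, the walk multiplies the frequency \<open>m\<close> by $(c \pm 1)/2$ on the even and
  odd combinations of the two cosets of $\langle a\rangle$ if \<open>m\<close> is even; if \<open>m\<close> is odd, the steps
  \<open>x\<close> and $a^n x$ cancel and only $c/2$ remains. These are the coefficients for the start at the
  identity, scaled by \<open>4n\<close>.\<close>

definition coef :: "nat \<Rightarrow> nat \<Rightarrow> bool \<Rightarrow> real" where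
  "coef k m b =
    (if even m then ((C m 1 + 1) / 2) ^ k + (if b then - 1 else 1) * ((C m 1 - 1) / 2) ^ k
     else if b then 0 else 2 * (C m 1 / 2) ^ k)"

lemma coef_0: "coef 0 m b = (if b then 0 else 2)"
  by (simp add: coef_def)

text \<open>One step mixes the two cosets by a 2 by 2 matrix; \<open>1 + (- 1) ^ m\<close> collects
  the two reflecting steps.\<close>

lemma coef_Suc: "coef (Suc k) m b = (2 * C m 1 * coef k m b + (1 + (- 1) ^ m) * coef k m (\<not> b)) / 4"
  by (simp add: coef_def field_simps)

lemma conv_power_Dic:
  assumes "(j, b) \<in> carrier (Dic n)"
  shows "conv_power (Dic n) Q k (j, b) = (\<Sum>m<2 * n. coef k m b * C m j) / (4 * real n)"
  using assms
proof (induction k arbitrary: j b)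
  case 0
  then have j: "0 \<le> j" "j < 2 * int n" by (auto simp: carrier_Dic)
  \<comment> \<open>Orthogonality of the cosines represents the point mass; the 2 in
    \<open>coef_0\<close> turns \<open>2 * n\<close> into \<open>4 * n\<close>.\<close>
  have "(\<Sum>m<2 * n. C m j) = (if j = 0 then 2 * real n else 0)"
    using sum_cos_mult_eq_0[of "nat j" n] j by (auto simp: C_def mult_ac)
  then show ?case
    using n_ge_2 by (auto simp: coef_0 one_Dic simp flip: sum_distrib_left)
next
  case (Suc k)
  define f where "f s = (\<Sum>m<2 * n. coef k m (snd s) * C m (fst s)) / (4 * real n)" for s
  \<comment> \<open>Symmetry of the kernel puts the fixed point second, as
    \<open>sum_Q_translate\<close> expects.\<close>
  have "conv_power (Dic n) Q (Suc k) (j, b)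
      = (\<Sum>t\<in>carrier (Dic n). Q (t \<otimes>\<^bsub>Dic n\<^esub> inv\<^bsub>Dic n\<^esub> (j, b)) * f t)"
    unfolding conv_power_Suc[OF finite_carrier Suc.prems]
    using Suc.IH Suc.prems by (intro sum.cong refl) (auto simp: Q_mult_inv_commute f_def)
  also have "\<dots> = (\<Sum>m<2 * n. coef k m b * (C m (j + 1) + C m (j - 1))
                       + (1 + (- 1) ^ m) * coef k m (\<not> b) * C m j) / 4 / (4 * real n)"
    unfolding sum_Q_translate[OF Suc.prems] f_def fst_conv snd_conv C_mod C_minus C_reflect
    by (simp add: sum.distrib algebra_simps add_divide_distrib)
  also have "\<dots> = (\<Sum>m<2 * n. coef (Suc k) m b * C m j) / (4 * real n)"
    unfolding sum_divide_distrib[of _ _ 4] coef_Suc C_neighbours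
    by (simp add: algebra_simps)
  finally show ?case .
qed

section \<open>The two distance bounds\<close>

lemma cos_multiple_le_exp:
  assumes "j \<le> n"
  shows "cos (pi * real j / (2 * real n)) ^ (4 * k)
           \<le> exp (- (pi\<^sup>2 * real k / (2 * (real n)\<^sup>2)) * (real j)\<^sup>2)"
proof -
  let ?x = "pi * real j / (2 * real n)"
  have x: "0 \<le> ?x" "?x \<le> pi / 2"
    using assms n_ge_2 by (auto simp: field_simps)
  then have "0 \<le> cos ?x"
    using pi_gt_zero by (intro cos_ge_zero) linarith+
  then have "cos ?x ^ (4 * k) \<le> exp (- (?x\<^sup>2 / 2)) ^ (4 * k)"
    using x by (intro power_mono cos_le_exp)
  also have "\<dots> = exp (- (pi\<^sup>2 * real k / (2 * (real n)\<^sup>2)) * (real j)\<^sup>2)"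
    by (simp add: power_mult_distrib power_divide flip: exp_of_nat_mult)
  finally show ?thesis .
qed

text \<open>Each of the \<open>n\<close> odd frequencies adds at most \<open>2 / 4 ^ k\<close>,
  frequency 0 cancels the \<open>- 1\<close>, and the other even ones are dominated by the Gaussian
  sum.\<close>

lemma tv_dist_upper:
  assumes "odd n" "k \<ge> 1" and U: "\<And>s. s \<in> carrier (Dic n) \<Longrightarrow> U s = 1 / card (carrier (Dic n))"
  shows "(tv_dist (carrier (Dic n)) (conv_power (Dic n) Q k) U)\<^sup>2
    \<le> real n / 2 * (1 / 4 ^ k) + exp (- (pi\<^sup>2 * real k / (2 * (real n)\<^sup>2)))
                  / (2 * (1 - exp (- (3 * pi\<^sup>2 * real k / (2 * (real n)\<^sup>2)))))"
proof -
  define b where "b = pi\<^sup>2 * real k / (2 * (real n)\<^sup>2)"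
  have b: "b > 0" using assms n_ge_2 by (simp add: b_def)
  obtain p where p: "n = 2 * p + 1" using \<open>odd n\<close> by (elim oddE)
  define f where "f l = cos (pi * real l / real n) ^ (4 * k) + sin (pi * real l / real n) ^ (4 * k)" for l
  have even: "coef (2 * k) (2 * l) False = f l" for l
  proof -
    define y where "y = pi * real l / real n"
    have "C (2 * l) 1 = cos (2 * y)" by (simp add: C_def y_def mult_ac)
    then have "(C (2 * l) 1 + 1) / 2 = (cos y)\<^sup>2" "(C (2 * l) 1 - 1) / 2 = - (sin y)\<^sup>2"
      by (simp_all add: cos_double_cos sin_squared_eq)
    then show ?thesis
      by (simp add: coef_def f_def power_minus_even flip: power_mult y_def)
  qed
  have odd: "coef (2 * k) (2 * l + 1) False \<le> 2 / 4 ^ k" for l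
  proof -
    have "C (2 * l + 1) 1 ^ (2 * k) \<le> 1"
      using abs_C_le_1[of "2 * l + 1" 1] by (simp add: power_mult abs_square_le_1 power_le_one)
    then show ?thesis
      by (simp add: coef_def power_divide power_mult divide_right_mono)
  qed
  have symm: "f (n - l) = f l" if "l \<le> n" for l
  proof -
    have "pi * real (n - l) / real n = pi - pi * real l / real n"
      using n_ge_2 that by (simp add: field_simps of_nat_diff)
    then show ?thesis by (simp add: f_def power_mult)
  qed
  have "(\<Sum>l<n. f l) = f 0 + (\<Sum>i<p. f (i + 1)) + (\<Sum>i<p. f (n - (i + 1)))"
  proof -
    have "(\<Sum>l<n. f l) = f 0 + (\<Sum>l<2 * p. f (l + 1))"
      unfolding p by (simp only: sum.lessThan_Suc_shift Suc_eq_plus1[symmetric])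
    also have "(\<Sum>l<2 * p. f (l + 1)) = (\<Sum>l<p. f (l + 1)) + (\<Sum>l=p..<p + p. f (l + 1))"
      using sum.atLeastLessThan_concat[of 0 p "2 * p" "\<lambda>l. f (l + 1)"]
      by (simp add: lessThan_atLeast0 mult_2)
    \<comment> \<open>Reversing the upper half lets \<open>symm\<close> match it with the lower
      half.\<close>
    also have "(\<Sum>l=p..<p + p. f (l + 1)) = (\<Sum>i<p. f (n - (i + 1)))"
      by (rule sum.reindex_bij_witness[where i = "\<lambda>i. 2 * p - 1 - i" and j = "\<lambda>l. 2 * p - 1 - l"])
        (auto simp: p intro!: arg_cong[where f = f])
    finally show ?thesis by simp
  qed
  also have "(\<Sum>i<p. f (n - (i + 1))) = (\<Sum>i<p. f (i + 1))"
    by (intro sum.cong refl symm) (auto simp: p)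
  also have "f 0 = 1" using \<open>k \<ge> 1\<close> by (simp add: f_def)
  finally have sum_f: "(\<Sum>l<n. f l) = 1 + 2 * (\<Sum>i<p. f (i + 1))" by simp
  have "(\<Sum>i<p. f (i + 1)) = (\<Sum>i<p. cos (pi * real (i + 1) / real n) ^ (4 * k))
                          + (\<Sum>i<p. sin (pi * real (p - Suc i + 1) / real n) ^ (4 * k))"
    unfolding f_def sum.distrib
    by (subst (2) sum.nat_diff_reindex[symmetric]) simp
  also have "\<dots> \<le> (\<Sum>i<p. exp (- b * (real (2 * (i + 1)))\<^sup>2)) + (\<Sum>i<p. exp (- b * (real (2 * i + 1))\<^sup>2))"
  proof (intro add_mono sum_mono)
    fix i assume i: "i \<in> {..<p}"
    have "pi * real (i + 1) / real n = pi * real (2 * (i + 1)) / (2 * real n)"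
      using n_ge_2 by (simp add: field_simps)
    then show "cos (pi * real (i + 1) / real n) ^ (4 * k) \<le> exp (- b * (real (2 * (i + 1)))\<^sup>2)"
      using cos_multiple_le_exp[of "2 * (i + 1)" k] i p by (simp only: b_def) simp
    have "pi * real (p - Suc i + 1) / real n = pi / 2 - pi * real (2 * i + 1) / (2 * real n)"
      using i by (simp add: p field_simps of_nat_diff)
    then have "sin (pi * real (p - Suc i + 1) / real n) = cos (pi * real (2 * i + 1) / (2 * real n))"
      by (simp only: sin_cos_eq) simp
    then show "sin (pi * real (p - Suc i + 1) / real n) ^ (4 * k) \<le> exp (- b * (real (2 * i + 1))\<^sup>2)"
      using cos_multiple_le_exp[of "2 * i + 1" k] i by (simp add: b_def p)
  qed
  also have "\<dots> \<le> exp (- b) / (1 - exp (- (3 * b)))"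
    using sum_exp_even_odd_squares_le[OF b, of p] by (simp add: sum.distrib add.commute)
  finally have main: "(\<Sum>i<p. f (i + 1)) \<le> exp (- b) / (1 - exp (- (3 * b)))" .
  have split: "(\<Sum>m<2 * N. g m) = (\<Sum>l<N. g (2 * l)) + (\<Sum>l<N. g (2 * l + 1))"
    for N and g :: "nat \<Rightarrow> real"
    by (induction N) auto
  have "(0, False) \<in> carrier (Dic n)" using one_closed by (simp add: one_Dic)
  then have "4 * real n * conv_power (Dic n) Q (2 * k) (0, False) = (\<Sum>m<2 * n. coef (2 * k) m False)"
    using n_ge_2 by (simp add: conv_power_Dic)
  also have "\<dots> = (\<Sum>l<n. f l) + (\<Sum>l<n. coef (2 * k) (2 * l + 1) False)"
    unfolding even[symmetric] by (rule split)
  also have "\<dots> \<le> (\<Sum>l<n. f l) + real n * (2 / 4 ^ k)"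
    using sum_mono[of "{..<n}", OF odd] by simp
  finally have bound: "4 * real n * conv_power (Dic n) Q (2 * k) (0, False)
      \<le> (\<Sum>l<n. f l) + real n * (2 / 4 ^ k)" .
  define E where "E = exp (- b) / (1 - exp (- (3 * b)))"
  define F where "F = real n / 2 * (1 / 4 ^ k)"
  have "real n * (2 / 4 ^ k) = 4 * F" by (simp add: F_def)
  \<comment> \<open>Four times the squared distance is at most \<open>4 * F + 2 * E\<close>.\<close>
  then have "(tv_dist (carrier (Dic n)) (conv_power (Dic n) Q k) U)\<^sup>2 \<le> F + E / 2"
    using tv_dist_conv_power_upper[where k = k and U = U, OF finite_carrier mass_Q Q_inv U]
      bound sum_f main[folded E_def] unfolding card_Dic one_Dic by simp
  moreover have "E / 2 = exp (- b) / (2 * (1 - exp (- (3 * b))))"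
    and "3 * b = 3 * pi\<^sup>2 * real k / (2 * (real n)\<^sup>2)"
    by (simp_all add: E_def b_def)
  ultimately show ?thesis
    by (simp only: F_def b_def)
qed

text \<open>As \<open>n\<close> is odd, \<open>n - 1\<close> is an even frequency next to
  \<open>n\<close>. The opposite signs on the two cosets select the eigenvalue
  \<open>(C (n - 1) 1 - 1) / 2\<close>, which is close to -1 for large \<open>n\<close>.\<close>

lemma tv_dist_lower:
  assumes "odd n" and U: "\<And>s. s \<in> carrier (Dic n) \<Longrightarrow> U s = 1 / card (carrier (Dic n))"
  shows "cos (pi / (2 * real n)) ^ (2 * k) / 2 \<le> tv_dist (carrier (Dic n)) (conv_power (Dic n) Q k) U"
proof -
  define h :: "int \<times> bool \<Rightarrow> real" where
    "h s = (if snd s then - 1 else 1) * C (n - 1) (fst s)" for s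
  define c where "c = (C (n - 1) 1 - 1) / 2"
  have "even (n - 1)" using \<open>odd n\<close> by simp
  have "pi * real (n - 1) / real n = pi - pi / real n"
    using n_ge_2 by (simp add: field_simps of_nat_diff)
  then have "C (n - 1) 1 = - cos (2 * (pi / (2 * real n)))"
    by (simp add: C_def)
  then have c: "\<bar>c\<bar> = (cos (pi / (2 * real n)))\<^sup>2"
    unfolding cos_double_cos by (simp add: c_def)
  have eigen: "(\<Sum>s\<in>carrier (Dic n). Q (s \<otimes>\<^bsub>Dic n\<^esub> inv\<^bsub>Dic n\<^esub> t) * h s) = c * h t"
    if "t \<in> carrier (Dic n)" for t
  proof (cases t)
    case (Pair j b)
    have "C (n - 1) (j + 1) = 2 * C (n - 1) 1 * C (n - 1) j - C (n - 1) (j - 1)"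
      using C_neighbours[of "n - 1" j] by simp
    then show ?thesis
      using \<open>even (n - 1)\<close>
      unfolding Pair sum_Q_translate[OF that[unfolded Pair]] h_def fst_conv snd_conv
        C_mod C_minus C_reflect c_def
      by (simp add: field_simps)
  qed
  \<comment> \<open>The two cosets cancel.\<close>
  have mean: "sum h (carrier (Dic n)) = 0"
    unfolding carrier_Dic sum.cartesian_product' by (simp add: h_def UNIV_bool)
  have "\<bar>c\<bar> ^ k / 2 \<le> tv_dist (carrier (Dic n)) (conv_power (Dic n) Q k) U"
    by (rule tv_dist_conv_power_lower[OF finite_carrier mass_Q U eigen mean])
      (auto simp: h_def one_Dic abs_C_le_1)
  then show ?thesis
    by (simp add: c power_mult)
qed

end

section \<open>The stated bounds, with the degenerate case \<open>n = 1\<close> apart\<close>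

theorem theorem4p1:
  fixes n :: nat and Q :: "(int \<times> bool) pmf"
  assumes "n \<ge> 1"
    and "set_pmf Q \<subseteq> carrier (Dic n)"
    and "pmf Q dic_a = 1/4"
    and "pmf Q (dic_a [^]\<^bsub>Dic n\<^esub> (2 * n - 1)) = 1/4"
    and "pmf Q dic_x = 1/4"
    and "pmf Q (dic_a [^]\<^bsub>Dic n\<^esub> n \<otimes>\<^bsub>Dic n\<^esub> dic_x) = 1/4"
  shows "(odd n \<longrightarrow> (\<forall>k::nat. k \<ge> 1 \<longrightarrow>
            (tv_dist (carrier (Dic n)) (conv_power (Dic n) (pmf Q) k) (pmf (pmf_of_set (carrier (Dic n)))))\<^sup>2
              \<le> (3 * real n - 1) / 4 * (1 / 4 ^ k)
                + exp (- (pi\<^sup>2 * real k / (2 * (real n)\<^sup>2)))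
                  / (2 * (1 - exp (- (3 * pi\<^sup>2 * real k / (2 * (real n)\<^sup>2)))))))
       \<and> (odd n \<and> n \<ge> 7 \<longrightarrow> (\<forall>k::nat. k \<ge> 1 \<longrightarrow>
            1 / 4 * exp (- (pi\<^sup>2 * real k / (4 * (real n)\<^sup>2))
                         - pi ^ 4 * real k / (96 * (real n) ^ 4)
                         - pi ^ 5 * real k / (400 * (real n) ^ 5))
              - 1 / 2 ^ (k + 2)
            \<le> tv_dist (carrier (Dic n)) (conv_power (Dic n) (pmf Q) k) (pmf (pmf_of_set (carrier (Dic n))))))"
proof -
  let ?U = "pmf (pmf_of_set (carrier (Dic n)))"
  have fin: "finite (carrier (Dic n))"
    by (simp add: carrier_Dic)
  interpret G: group "Dic n"
    by (rule group_Dic[OF assms(1)])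
  have U: "?U s = 1 / card (carrier (Dic n))" if "s \<in> carrier (Dic n)" for s
    using that fin by (subst pmf_of_set) auto
  have pow_a: "dic_a [^]\<^bsub>Dic n\<^esub> (2 * n - 1) = (2 * int n - 1, False)"
    using assms(1) by (simp add: dic_a_pow of_nat_diff zmod_minus1)
  have pow_a_x: "dic_a [^]\<^bsub>Dic n\<^esub> n \<otimes>\<^bsub>Dic n\<^esub> dic_x = (int n, True)"
    using assms(1) by (simp add: dic_a_pow dic_x_def mult_Dic)
  show ?thesis
  proof (cases "n = 1")
    case True
    \<comment> \<open>Now $a = a^{2n-1}$, so the prescribed masses add up to $3/4$ only and the identity carries
      the rest: \<open>Q\<close> is uniform.\<close>
    have C: "carrier (Dic n) = {(0, False), (1, False), (0, True), (1, True)}"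
      using True by (auto simp: carrier_Dic)
    have mass: "sum (pmf Q) (carrier (Dic n)) = 1"
      by (rule sum_pmf_eq_1[OF fin assms(2)])
    have Q: "pmf Q s = 1 / 4" if "s \<in> carrier (Dic n)" for s
      using that mass True assms(3-6) pow_a_x unfolding C by (auto simp: dic_a_def dic_x_def)
    have "conv_power (Dic n) (pmf Q) k s = ?U s" if k: "k \<ge> 1" and s: "s \<in> carrier (Dic n)" for k s
    proof -
      \<comment> \<open>One constant factor \<open>Q\<close> is split off; the rest, possibly the
        point mass, has total mass 1.\<close>
      obtain i where "k = Suc i" using k by (cases k) auto
      then have "conv_power (Dic n) (pmf Q) k s = (\<Sum>t\<in>carrier (Dic n). 1 / 4 * conv_power (Dic n) (pmf Q) i t)"
        using s by (simp only: G.conv_power_Suc[OF fin]) (simp add: Q)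
      also have "\<dots> = 1 / 4"
        unfolding sum_distrib_left[symmetric] G.sum_conv_power[OF fin mass] by simp
      finally show ?thesis
        unfolding U[OF s] card_Dic using True by simp
    qed
    then have "tv_dist (carrier (Dic n)) (conv_power (Dic n) (pmf Q) k) ?U = 0" if "k \<ge> 1" for k
      using that by (subst tv_dist_eq_half_sum[OF fin]) simp_all
    then show ?thesis
      using True by (simp add: add_nonneg_nonneg)
  next
    case False
    let ?S = "{(1, False), (2 * int n - 1, False), (0, True), (int n, True)} :: (int \<times> bool) set"
    have S: "pmf Q s = 1 / 4" if "s \<in> ?S" for s
      using that assms(3-6) pow_a pow_a_x by (auto simp: dic_a_def dic_x_def)
    \<comment> \<open>The four distinct points already carry total mass 1.\<close>
    have "pmf Q s = 0" if "s \<notin> ?S" for s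
    proof -
      have "(\<Sum>q\<in>insert s ?S. pmf Q q) \<le> 1"
        using measure_pmf.prob_le_1[of Q "insert s ?S"] by (simp add: measure_measure_pmf_finite)
      moreover have "(\<Sum>q\<in>insert s ?S. pmf Q q) = pmf Q s + sum (pmf Q) ?S"
        using that by (intro sum.insert) auto
      moreover have "sum (pmf Q) ?S = 1"
        using False assms(1) S[of "(1, False)"] S[of "(2 * int n - 1, False)"] S[of "(0, True)"]
          S[of "(int n, True)"] by simp
      ultimately show ?thesis
        using pmf_nonneg[of Q s] by linarith
    qed
    then interpret dicyclic_walk n "pmf Q"
      using False assms(1) S by unfold_locales auto
    show ?thesis
    proof (intro conjI impI allI)
      fix k :: nat assume k: "k \<ge> 1"
      show "(tv_dist (carrier (Dic n)) (conv_power (Dic n) (pmf Q) k) (pmf (pmf_of_set (carrier (Dic n)))))\<^sup>2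
          \<le> (3 * real n - 1) / 4 * (1 / 4 ^ k)
            + exp (- (pi\<^sup>2 * real k / (2 * (real n)\<^sup>2)))
              / (2 * (1 - exp (- (3 * pi\<^sup>2 * real k / (2 * (real n)\<^sup>2)))))" if "odd n"
      proof -
        \<comment> \<open>The bound proved has the smaller constant \<open>n / 2\<close>; the
          comparison is \<open>n \<ge> 1\<close>.\<close>
        have "real n / 2 * (1 / 4 ^ k) \<le> (3 * real n - 1) / 4 * (1 / 4 ^ k)"
          using assms(1) by (intro mult_right_mono) auto
        with tv_dist_upper[where U = ?U, OF that k U] show ?thesis by linarith
      qed
      assume n: "odd n \<and> n \<ge> 7"
      define x where "x = pi / (2 * real n)"
      have x: "0 \<le> x" "x \<le> 1 / 2"
        using n pi_less_4 by (auto simp: x_def field_simps)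
      have "exp (- (x^2 / 2 + x^4 / 12 + x^5 / 25)) ^ (2 * k) \<le> cos x ^ (2 * k)"
        by (intro power_mono exp_le_cos x) auto
      moreover have "- (pi\<^sup>2 * real k / (4 * (real n)\<^sup>2)) - pi ^ 4 * real k / (96 * (real n) ^ 4)
          - pi ^ 5 * real k / (400 * (real n) ^ 5) = real (2 * k) * (- (x^2 / 2 + x^4 / 12 + x^5 / 25))"
        by (simp add: x_def power_mult_distrib power_divide algebra_simps)
      ultimately have "exp (- (pi\<^sup>2 * real k / (4 * (real n)\<^sup>2)) - pi ^ 4 * real k / (96 * (real n) ^ 4)
          - pi ^ 5 * real k / (400 * (real n) ^ 5)) \<le> cos x ^ (2 * k)"
        by (simp only: exp_of_nat_mult)
      \<comment> \<open>The eigenfunction gives the factor 1/2 without a subtracted term, which is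
        stronger.\<close>
      then show "1 / 4 * exp (- (pi\<^sup>2 * real k / (4 * (real n)\<^sup>2)) - pi ^ 4 * real k / (96 * (real n) ^ 4)
            - pi ^ 5 * real k / (400 * (real n) ^ 5)) - 1 / 2 ^ (k + 2)
          \<le> tv_dist (carrier (Dic n)) (conv_power (Dic n) (pmf Q) k) (pmf (pmf_of_set (carrier (Dic n))))"
        using tv_dist_lower[where U = ?U and k = k, OF conjunct1[OF n] U] zero_le_power[of "1 / 2 :: real" "k + 2"]
          zero_le_even_power'[of "cos x" k]
        unfolding x_def[symmetric] power_one_over by linarith
    qed
  qed
qed

end
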